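(* Let $m$ and $n$ be non-negative integers with $m\le n$. Then $$\sum_{k=0}^\infty (-1)^k\,\frac{\left(\frac12\right)_k^3}{k!^3}\,\frac{(4k+1-2m)\,\bigl(2O_{k-m}-2O_m+H_k\bigr)}{\prod_{j=1}^m(2k-2j+1)^2\,\prod_{j=1}^n(2k-2j+1)\,\prod_{j=1}^{n-m}(k+j)}=\frac{(-1)^{m+n}}{\left(\frac12\right)_m\left(\frac12\right)_n^2}\,\frac{1}{2^{2m+n-2}}\,\frac1\pi\,\left(O_n-\ln 2\right).$$ In particular, for every non-negative integer $n$, $$\sum_{k=0}^\infty (-1)^k\,\frac{\left(\frac12\right)_k^3}{k!^3}\,\frac{(4k+1)\,H_{2k}}{\prod_{j=1}^n(2k-2j+1)(k+j)}=\frac{(-1)^n}{2^{n-1}}\,\frac{O_n-\ln 2}{\left(\frac12\right)_n^2}\,\frac1\pi,$$ with the special value $$\sum_{k=0}^\infty (-1)^k\,\frac{\left(\frac12\right)_k^3}{k!^3}\,(4k+1)\,H_{2k}=-\frac{2\ln 2}{\pi}.$$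
   Context: $(x)_n=\prod_{j=0}^{n-1}(x+j)$ is the Pochhammer symbol; empty products equal $1$, and $\prod_{j=1}^n(2k-2j+1)(k+j)$ extends over both factors. For non-negative integers $j$, $H_j=\sum_{i=1}^j \frac1i$ and $O_j=\sum_{i=1}^j\frac1{2i-1}$, with $H_0=O_0=0$. For complex $z$ that is not a negative integer, $H_z=\psi(z+1)+\gamma$, where $\psi$ is the digamma function and $\gamma$ is Euler's constant. For negative integers $j$, $O_j$ is defined by the relation $H_{j-1/2}=2O_j-2\ln 2$ (which holds for non-negative $j$); equivalently $O_{-j}=O_j$ for all integers $j$. Infinite series are understood as limits of partial sums (convergence may be conditional). *)

theory Defs
  imports "HOL-Analysis.Analysis"
begin

text \<open>
  \<open>H\<^sub>z = \<psi>(z + 1) + \<gamma>\<close>, meaningful when \<open>z\<close> is not a negative integer. For natural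
  numbers it agrees with \<^const>\<open>harm\<close>.
\<close>

definition harm_ext :: "'a :: {real_normed_field, banach} \<Rightarrow> 'a" where
  "harm_ext z = Digamma (z + 1) + euler_mascheroni"

lemma harm_ext_of_nat: "harm_ext (of_nat n) = harm n"
  using Digamma_of_nat[of n, where ?'a = 'a]
  by (simp add: harm_ext_def add.commute)

text \<open>
  For negative \<open>j\<close> the value of \<open>O\<^sub>j\<close> is determined by \<open>H\<^bsub>j - 1/2\<^esub> = 2 O\<^sub>j - 2 ln 2\<close>;
  the lemmas below confirm this relation for all integers \<open>j\<close>, and the symmetry \<open>O\<^bsub>-j\<^esub> = O\<^sub>j\<close>.
\<close>

definition odd_harm :: "int \<Rightarrow> real" where
  "odd_harm j =
     (if j \<ge> 0 then (\<Sum>i = 1..nat j. 1 / (2 * real i - 1))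
      else (harm_ext (real_of_int j - 1 / 2) + 2 * ln 2) / 2)"

lemma harm_ext_half_nat: "harm_ext (real n - 1 / 2) = 2 * odd_harm (int n) - 2 * ln 2"
proof -
  have "(\<Sum>k<n. 2 / real (2 * k + 1)) = 2 * (\<Sum>i = 1..n. 1 / (2 * real i - 1))"
    by (induction n) (auto simp: add.commute)
  then show ?thesis
    using Digamma_half_integer[of n, where ?'a = real]
    by (simp add: harm_ext_def odd_harm_def add.commute)
qed

lemma harm_ext_half_minus_nat: "harm_ext (- real n - 1 / 2) = harm_ext (real n - 1 / 2)"
proof (induction n)
  case 0
  show ?case by simp
next
  case (Suc n)
  define a where "a = real n + 1 / 2"
  have "a \<noteq> 0"
    unfolding a_def by linarith
  then have pos: "Digamma (a + 1) = Digamma a + 1 / a" and neg: "Digamma (- a + 1) = Digamma (- a) - 1 / a"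
    using Digamma_plus1[of a] Digamma_plus1[of "- a"] by simp_all
  have "real (Suc n) - 1 / 2 + 1 = a + 1" "- real (Suc n) - 1 / 2 + 1 = - a"
    and IH_args: "real n - 1 / 2 + 1 = a" "- real n - 1 / 2 + 1 = - a + 1"
    by (simp_all add: a_def)
  moreover have "Digamma (- a + 1) = Digamma a"
    using Suc unfolding harm_ext_def IH_args by (rule add_right_imp_eq)
  ultimately show ?case
    unfolding harm_ext_def using pos neg by (simp only: diff_eq_eq eq_diff_eq)
qed

lemma harm_ext_half: "harm_ext (real_of_int j - 1 / 2) = 2 * odd_harm j - 2 * ln 2"
proof (cases "j \<ge> 0")
  case True
  then show ?thesis using harm_ext_half_nat[of "nat j"] by simp
qed (simp add: odd_harm_def field_simps)

lemma odd_harm_minus: "odd_harm (- j) = odd_harm j"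
proof -
  have "harm_ext (- real_of_int j - 1 / 2) = harm_ext (real_of_int j - 1 / 2)"
    using harm_ext_half_minus_nat[of "nat \<bar>j\<bar>"] by (cases "j \<ge> 0") auto
  then show ?thesis
    using harm_ext_half[of j] harm_ext_half[of "- j"] by simp
qed

end

theory Submission
  imports Defs "HOL-Real_Asymp.Real_Asymp"
begin

text \<open>
  Behind the theorem is the summation of the well-poised series at \<open>-1\<close>,
  \<open>\<Sum>k. (-1)\<^sup>k (a + 2 k) / a \<cdot> (a)\<^sub>k (b)\<^sub>k (c)\<^sub>k / (k! (1 + a - b)\<^sub>k (1 + a - c)\<^sub>k)
    = \<Gamma>(1 + a - b) \<Gamma>(1 + a - c) / (\<Gamma>(1 + a) \<Gamma>(1 + a - b - c))\<close>,
  differentiated with respect to \<open>b\<close>. Differentiation multiplies the \<open>k\<close>-th term by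
  \<open>\<Sum>j<k. 1 / (b + j) + 1 / (1 + a - b + j)\<close> and the right-hand side by
  \<open>\<psi>(1 + a - b - c) - \<psi>(1 + a - b)\<close>. For \<open>a = b = 1/2 - m\<close> and \<open>c = 1/2 - n\<close> the former is
  \<open>2 O\<^bsub>k-m\<^esub> - 2 O\<^sub>m + H\<^sub>k\<close>, the latter is \<open>2 O\<^sub>n - 2 ln 2\<close>, and the products over \<open>j\<close> in the
  denominators are what turns \<open>(1/2)\<^sub>k\<close> into \<open>(1/2 - m)\<^sub>k\<close> and \<open>(1/2 - n)\<^sub>k\<close>, and \<open>k!\<close> into
  \<open>(1 + n - m)\<^sub>k\<close>.
  
  The differentiated formula is proved by shifting \<open>a\<close>. The terms at \<open>a\<close> and at \<open>a + 1\<close> differ,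
  up to a constant factor, by a telescoping difference (\<open>wp_telescope\<close>), and this identity can be
  differentiated in \<open>b\<close> before anything is summed (\<open>wp_telescope_deriv\<close>); hence no
  interchange of derivative and conditionally convergent series occurs. The boundary terms vanish by
  the growth of Pochhammer symbols (\<open>wp_boundary_tendsto_0\<close>), so each shift carries convergence and
  value of the series from \<open>a + 1\<close> to \<open>a\<close> (\<open>wp_sums_step\<close>). For large \<open>a\<close> the series converges
  absolutely and only the term \<open>k = 0\<close> survives as \<open>a\<close> tends to infinity (\<open>wp_sums_large\<close>).
  The accumulated factors converge to Gamma and Digamma values by their classical limit
  representations, which gives \<open>well_poised_deriv_sums\<close>.
\<close>

section \<open>Well-poised terms and their telescoping in the first parameter\<close>

text \<open>
  The quotient \<open>(a)\<^sub>k / a\<close> is \<open>(a + 1)\<^sub>k\<^sub>-\<^sub>1\<close> for \<open>k \<ge> 1\<close>. Dividing by \<open>a\<close> makes the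
  term below equal to \<open>1\<close> at \<open>k = 0\<close>. The factor \<open>a + 2 k\<close> of the term is kept apart because
  the kernel alone, multiplied by \<open>- k\<close>, is the telescoping antidifference.
\<close>

definition wp_kernel :: "real \<Rightarrow> real \<Rightarrow> real \<Rightarrow> nat \<Rightarrow> real" where
  "wp_kernel a b c k =
     (-1) ^ k * (pochhammer a k * pochhammer b k * pochhammer c k) /
     (a * (fact k * pochhammer (1 + a - b) k * pochhammer (1 + a - c) k))"

definition wp_term :: "real \<Rightarrow> real \<Rightarrow> real \<Rightarrow> nat \<Rightarrow> real" where
  "wp_term a b c k = (a + 2 * real k) * wp_kernel a b c k"

text \<open>
  The logarithmic derivative of \<^term>\<open>wp_term a b c k\<close> in \<open>b\<close>: the first summands come from
  \<open>(b)\<^sub>k\<close>, the second from \<open>1 / (1 + a - b)\<^sub>k\<close>.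
\<close>

definition wp_dlog :: "real \<Rightarrow> real \<Rightarrow> nat \<Rightarrow> real" where
  "wp_dlog a b k = (\<Sum>j<k. 1 / (b + real j) + 1 / (1 + a - b + real j))"

lemma nonpos_Ints_plus_of_nat_neq_0:
  fixes x :: "'a :: ring_char_0"
  assumes "x \<notin> \<int>\<^sub>\<le>\<^sub>0"
  shows "x + of_nat k \<noteq> 0"
  using assms by (metis add.inverse_unique add.commute minus_of_nat_in_nonpos_Ints)

lemma nonpos_Ints_plus_of_nat:
  fixes x :: "'a :: ring_char_0"
  assumes "x \<notin> \<int>\<^sub>\<le>\<^sub>0"
  shows "x + of_nat k \<notin> \<int>\<^sub>\<le>\<^sub>0"
proof
  assume "x + of_nat k \<in> \<int>\<^sub>\<le>\<^sub>0"
  then obtain n where "x + of_nat k = - of_nat n" by (elim nonpos_Ints_cases')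
  then have "x + of_nat (k + n) = 0" by (simp add: algebra_simps eq_neg_iff_add_eq_0)
  then show False using nonpos_Ints_plus_of_nat_neq_0[OF assms] by blast
qed

lemma pochhammer_plus_1:
  fixes x :: "'a :: field_char_0"
  assumes "x \<noteq> 0"
  shows "pochhammer (x + 1) k = pochhammer x k * (x + of_nat k) / x"
  using pochhammer_rec[of x k] pochhammer_rec'[of x k] assms by (simp add: field_simps)

lemma wp_kernel_Suc:
  "wp_kernel a b c (Suc k) =
     - wp_kernel a b c k * ((a + real k) * (b + real k) * (c + real k)) /
       (real (Suc k) * (1 + a - b + real k) * (1 + a - c + real k))"
  by (simp add: wp_kernel_def pochhammer_Suc mult_ac)

lemma wp_kernel_plus_1:
  assumes "a \<notin> \<int>\<^sub>\<le>\<^sub>0" "1 + a - b \<notin> \<int>\<^sub>\<le>\<^sub>0" "1 + a - c \<notin> \<int>\<^sub>\<le>\<^sub>0"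
  shows "wp_kernel (a + 1) b c k =
     wp_kernel a b c k * (a + real k) / (a + 1) * ((1 + a - b) * (1 + a - c)) /
       ((1 + a - b + real k) * (1 + a - c + real k))"
proof -
  have nz: "a \<noteq> 0" "1 + a - b \<noteq> 0" "1 + a - c \<noteq> 0"
    using assms by auto
  have e: "1 + (a + 1) - b = (1 + a - b) + 1" "1 + (a + 1) - c = (1 + a - c) + 1" by simp_all
  show ?thesis
    unfolding wp_kernel_def e pochhammer_plus_1[OF nz(1)] pochhammer_plus_1[OF nz(2)]
      pochhammer_plus_1[OF nz(3)]
    using nz by (simp add: mult_ac)
qed

text \<open>
  The quotient of the values \<open>\<Gamma>(1+a-b) \<Gamma>(1+a-c) / (\<Gamma>(1+a) \<Gamma>(1+a-b-c))\<close> at \<open>a\<close> and at \<open>a + 1\<close>.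
\<close>

definition wp_ratio :: "real \<Rightarrow> real \<Rightarrow> real \<Rightarrow> real" where
  "wp_ratio a b c = (1 + a) * (1 + a - b - c) / ((1 + a - b) * (1 + a - c))"

lemma wp_ratio_term:
  assumes "a \<notin> \<int>\<^sub>\<le>\<^sub>0" "1 + a - b \<notin> \<int>\<^sub>\<le>\<^sub>0" "1 + a - c \<notin> \<int>\<^sub>\<le>\<^sub>0"
  shows "wp_ratio a b c * wp_term (a + 1) b c k =
     (1 + a - b - c) * (a + 1 + 2 * real k) * (a + real k) * wp_kernel a b c k /
       ((1 + a - b + real k) * (1 + a - c + real k))"
proof -
  have nz: "1 + a - b \<noteq> 0" "1 + a - c \<noteq> 0" "a + 1 \<noteq> 0" "1 + a \<noteq> 0"
    using assms nonpos_Ints_plus_of_nat_neq_0[OF assms(1), of 1] by auto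
  show ?thesis
    unfolding wp_term_def wp_ratio_def wp_kernel_plus_1[OF assms] add.commute[of 1 a]
    using nz by (simp add: mult_ac add.commute[of 1 a])
qed

text \<open>
  After division by the kernel and clearing denominators this is a polynomial identity of degree
  three in \<open>k\<close>. The multiplier \<open>k\<close> of the kernel does not involve \<open>b\<close>, which is what
  makes the differentiated identity below equally short.
\<close>

lemma wp_telescope:
  assumes "a \<notin> \<int>\<^sub>\<le>\<^sub>0" "1 + a - b \<notin> \<int>\<^sub>\<le>\<^sub>0" "1 + a - c \<notin> \<int>\<^sub>\<le>\<^sub>0"
  shows "wp_term a b c k = wp_ratio a b c * wp_term (a + 1) b c k
     + (real k * wp_kernel a b c k - real (Suc k) * wp_kernel a b c (Suc k))"
proof -
  have nz: "1 + a - b + real k \<noteq> 0" "1 + a - c + real k \<noteq> 0"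
    using assms nonpos_Ints_plus_of_nat_neq_0 by blast+
  define x y where "x = 1 + a - b + real k" and "y = 1 + a - c + real k"
  have s: "real (Suc k) * wp_kernel a b c (Suc k) =
      - wp_kernel a b c k * ((a + real k) * (b + real k) * (c + real k)) / (x * y)"
    unfolding wp_kernel_Suc x_def y_def by simp
  have "(a + 2 * real k) * (x * y) = (1 + a - b - c) * (a + 1 + 2 * real k) * (a + real k)
      + (real k * (x * y) + (a + real k) * (b + real k) * (c + real k))"
    unfolding x_def y_def by algebra
  moreover have "x * y \<noteq> 0" using nz by (simp add: x_def y_def)
  moreover have "p * v = q * v / d + (real k * v - (- v * r / d))"
    if "p * d = q + (real k * d + r)" "d \<noteq> 0" for p q r v d :: real
  proof -
    have "p = q / d + (real k + r / d)"
      using that by (simp add: field_simps)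
    then show ?thesis by (simp add: algebra_simps)
  qed
  ultimately show ?thesis
    unfolding wp_ratio_term[OF assms] s unfolding wp_term_def x_def[symmetric] y_def[symmetric]
    by blast
qed

lemma wp_dlog_plus_1:
  "wp_dlog (a + 1) b k = wp_dlog a b k + 1 / (1 + a - b + real k) - 1 / (1 + a - b)"
  by (induction k) (simp_all add: wp_dlog_def algebra_simps)

text \<open>
  This is the derivative of \<open>wp_telescope\<close> with respect to \<open>b\<close>: the difference
  \<open>1 / (1 + a - b) - 1 / (1 + a - b - c)\<close> is the logarithmic derivative of
  \<^term>\<open>wp_ratio a b c\<close>. It is verified algebraically from \<open>wp_telescope\<close>, so that no
  differentiation under the summation sign is needed.
\<close>

lemma wp_telescope_deriv:
  assumes "a \<notin> \<int>\<^sub>\<le>\<^sub>0" "b \<notin> \<int>\<^sub>\<le>\<^sub>0" "1 + a - b \<notin> \<int>\<^sub>\<le>\<^sub>0" "1 + a - c \<notin> \<int>\<^sub>\<le>\<^sub>0" "1 + a - b - c \<noteq> 0"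
  shows "wp_term a b c k * wp_dlog a b k =
     wp_ratio a b c * (wp_term (a + 1) b c k * wp_dlog (a + 1) b k
       + (1 / (1 + a - b) - 1 / (1 + a - b - c)) * wp_term (a + 1) b c k)
     + (real k * wp_kernel a b c k * wp_dlog a b k
        - real (Suc k) * wp_kernel a b c (Suc k) * wp_dlog a b (Suc k))"
proof -
  define x y z where "x = 1 + a - b + real k" and "y = 1 + a - c + real k" and "z = 1 + a - b - c"
  define l where "l = wp_dlog a b k"
  have nz: "x \<noteq> 0" "y \<noteq> 0" "b + real k \<noteq> 0" "z \<noteq> 0"
    using assms nonpos_Ints_plus_of_nat_neq_0 unfolding x_def y_def z_def by blast+
  define w where "w = wp_ratio a b c * wp_term (a + 1) b c k"
  define v where "v = real (Suc k) * wp_kernel a b c (Suc k)"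
  have w: "w = z * (a + 1 + 2 * real k) * (a + real k) * wp_kernel a b c k / (x * y)"
    unfolding w_def x_def y_def z_def using assms by (intro wp_ratio_term)
  have v: "v = - wp_kernel a b c k * ((a + real k) * (b + real k) * (c + real k)) / (x * y)"
    unfolding wp_kernel_Suc x_def y_def v_def by simp
  \<comment> \<open>What remains after subtracting \<open>l\<close> times \<open>wp_telescope\<close>.\<close>
  have key: "w * (1 / z - 1 / x) = - v * (1 / (b + real k) + 1 / x)"
  proof -
    have "1 / z - 1 / x = (c + real k) / (z * x)"
      using nz by (simp add: divide_simps) (simp add: x_def z_def)
    moreover have "1 / (b + real k) + 1 / x = (a + 1 + 2 * real k) / ((b + real k) * x)"
      using nz by (simp add: divide_simps) (simp add: x_def)
    ultimately show ?thesis
      unfolding w v using nz by (simp add: mult_ac)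
  qed
  have t: "wp_term a b c k = w + (real k * wp_kernel a b c k - v)"
    unfolding w_def v_def using assms by (intro wp_telescope)
  have dl: "wp_dlog (a + 1) b k = l + 1 / x - 1 / (1 + a - b)"
    unfolding l_def x_def by (rule wp_dlog_plus_1)
  have ds: "wp_dlog a b (Suc k) = l + (1 / (b + real k) + 1 / x)"
    by (simp add: l_def wp_dlog_def x_def)
  have fac: "wp_ratio a b c * (wp_term (a + 1) b c k * L + d * wp_term (a + 1) b c k) = w * (L + d)"
    for L d by (simp add: w_def algebra_simps)
  have "w * (l + 1 / x - 1 / (1 + a - b) + (1 / (1 + a - b) - 1 / z)) =
      w * l - w * (1 / z - 1 / x)"
    by (simp add: algebra_simps)
  then show ?thesis
    unfolding z_def[symmetric] l_def[symmetric] v_def[symmetric] fac t dl ds key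
    by (simp only:) (simp add: algebra_simps)
qed

section \<open>Decay of the boundary terms\<close>

text \<open>
  A rescaling of Gauss's limit for \<open>1 / \<Gamma>\<close>, with the power of \<open>k\<close> that makes quotients of
  Pochhammer symbols easy to compare.
\<close>

lemma pochhammer_asymp:
  "(\<lambda>k. pochhammer x k / (fact k * real k powr (x - 1))) \<longlonglongrightarrow> rGamma (x :: real)"
proof -
  have "(\<lambda>k. rGamma_series x k * (real k / (x + real k))) \<longlonglongrightarrow> rGamma x * 1"
    by (intro tendsto_mult rGamma_series_LIMSEQ) real_asymp
  moreover have "\<forall>\<^sub>F k in sequentially. rGamma_series x k * (real k / (x + real k)) =
      pochhammer x k / (fact k * real k powr (x - 1))"
    using eventually_gt_at_top[of "nat \<lceil>\<bar>x\<bar>\<rceil>"]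
  proof eventually_elim
    case (elim k)
    then have "x + real k > 0" "k > 0" by linarith+
    then have "exp (x * ln (real k)) = real k powr (x - 1) * real k"
      using powr_add[of "real k" "x - 1" 1] by (simp add: powr_def)
    then show ?case
      using \<open>x + real k > 0\<close> \<open>k > 0\<close> by (simp add: rGamma_series_def pochhammer_Suc mult_ac)
  qed
  ultimately show ?thesis by (simp cong: filterlim_cong)
qed

lemma wp_kernel_asymp:
  assumes "1 + a - b \<notin> \<int>\<^sub>\<le>\<^sub>0" "1 + a - c \<notin> \<int>\<^sub>\<le>\<^sub>0"
  shows "(\<lambda>k. (-1) ^ k * (real k * wp_kernel a b c k) / real k powr (2 * b + 2 * c - a - 2)) \<longlonglongrightarrow>
     rGamma a * rGamma b * rGamma c / (a * rGamma (1 + a - b) * rGamma (1 + a - c))"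
proof (cases "a = 0")
  case False
  define A where "A = (\<lambda>x k. pochhammer x k / (fact k * real k powr (x - 1)))"
  have "(\<lambda>k. A a k * A b k * A c k / (a * A (1 + a - b) k * A (1 + a - c) k)) \<longlonglongrightarrow>
     rGamma a * rGamma b * rGamma c / (a * rGamma (1 + a - b) * rGamma (1 + a - c))"
    unfolding A_def using assms False
    by (intro tendsto_intros pochhammer_asymp) (simp add: rGamma_eq_zero_iff)
  moreover have "\<forall>\<^sub>F k in sequentially. A a k * A b k * A c k / (a * A (1 + a - b) k * A (1 + a - c) k) =
     (-1) ^ k * (real k * wp_kernel a b c k) / real k powr (2 * b + 2 * c - a - 2)"
    using eventually_gt_at_top[of 0]
  proof eventually_elim
    case (elim k)
    then have k: "real k > 0" by simp
    have p: "real k powr (a - 1) * real k powr (b - 1) * real k powr (c - 1) * real k =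
       real k powr (2 * b + 2 * c - a - 2) * (real k powr (a - b) * real k powr (a - c))"
    proof -
      have "real k powr (a - 1) * real k powr (b - 1) * real k powr (c - 1) * real k powr 1 =
       real k powr (2 * b + 2 * c - a - 2) * (real k powr (a - b) * real k powr (a - c))"
        unfolding powr_add[symmetric] by (simp add: algebra_simps)
      then show ?thesis using k by simp
    qed
    define P where "P = real k powr (2 * b + 2 * c - a - 2)"
    have P: "1 / P = (real k powr (a - b) * real k powr (a - c)) / (real k powr (a - 1) * real k powr (b - 1) * real k powr (c - 1) * real k)"
      unfolding p P_def using k by simp
    have sg: "(-1 :: real) ^ k * (-1) ^ k = 1"
      by (simp flip: power_mult_distrib)
    have "A a k * A b k * A c k / (a * A (1 + a - b) k * A (1 + a - c) k) =
       ((-1) ^ k * (-1) ^ k) * (real k * (pochhammer a k * pochhammer b k * pochhammer c k) /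
     (a * (fact k * pochhammer (1 + a - b) k * pochhammer (1 + a - c) k))) * (1 / P)"
      unfolding P sg A_def using k by (simp add: mult_ac)
    then show ?case unfolding wp_kernel_def P_def by (simp add: mult_ac)
  qed
  ultimately show ?thesis by (simp cong: filterlim_cong)
qed (simp add: wp_kernel_def)

lemma wp_dlog_asymp:
  assumes "b \<notin> \<int>\<^sub>\<le>\<^sub>0" "1 + a - b \<notin> \<int>\<^sub>\<le>\<^sub>0"
  shows "(\<lambda>k. 2 * ln (real k) - wp_dlog a b k) \<longlonglongrightarrow> Digamma b + Digamma (1 + a - b)"
proof -
  have "b \<noteq> 0" "1 + a - b \<noteq> 0" using assms by auto
  from tendsto_add[OF Digamma_LIMSEQ[OF this(1)] Digamma_LIMSEQ[OF this(2)]]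
  show ?thesis
    by (simp add: wp_dlog_def sum.distrib divide_inverse algebra_simps)
qed

text \<open>
  The boundary term decays like \<open>k powr (2 b + 2 c - a - 2)\<close>, and \<^const>\<open>wp_dlog\<close> grows only
  like \<open>2 ln k\<close>. As that exponent is negative, both products vanish in the limit, even where
  the series itself converges only conditionally.
\<close>

lemma wp_boundary_tendsto_0:
  assumes "b \<notin> \<int>\<^sub>\<le>\<^sub>0" "1 + a - b \<notin> \<int>\<^sub>\<le>\<^sub>0" "1 + a - c \<notin> \<int>\<^sub>\<le>\<^sub>0"
    and "2 * b + 2 * c < a + 2"
  shows "(\<lambda>k. real k * wp_kernel a b c k) \<longlonglongrightarrow> 0"
    and "(\<lambda>k. real k * wp_kernel a b c k * wp_dlog a b k) \<longlonglongrightarrow> 0"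
proof -
  define s where "s = 2 * b + 2 * c - a - 2"
  have s: "s < 0" using assms by (simp add: s_def)
  define A where "A = (\<lambda>k. (-1) ^ k * (real k * wp_kernel a b c k) / real k powr s)"
  define D where "D = (\<lambda>k. 2 * ln (real k) - wp_dlog a b k)"
  obtain lA where lA: "A \<longlonglongrightarrow> lA"
    unfolding A_def s_def using wp_kernel_asymp[OF assms(2,3)] by blast
  obtain lD where lD: "D \<longlonglongrightarrow> lD"
    unfolding D_def using wp_dlog_asymp[OF assms(1,2)] by blast
  have p0: "(\<lambda>k. real k powr s) \<longlonglongrightarrow> 0" and p1: "(\<lambda>k. real k powr s * ln (real k)) \<longlonglongrightarrow> 0"
    using s by real_asymp+
  have "(\<lambda>k. A k * (real k powr s)) \<longlonglongrightarrow> lA * 0"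
    by (intro tendsto_intros lA p0)
  then have 1: "(\<lambda>k. (-1) ^ k * (real k * wp_kernel a b c k)) \<longlonglongrightarrow> 0"
    unfolding A_def by (auto elim!: Lim_transform_eventually intro: eventually_mono[OF eventually_gt_at_top[of 0]])
  have "(\<lambda>k. A k * (2 * (real k powr s * ln (real k)) - real k powr s * D k)) \<longlonglongrightarrow> lA * (2 * 0 - 0 * lD)"
    by (intro tendsto_intros lA p0 p1 lD)
  moreover have "\<forall>\<^sub>F k in sequentially. A k * (2 * (real k powr s * ln (real k)) - real k powr s * D k)
    = (-1) ^ k * (real k * wp_kernel a b c k * wp_dlog a b k)"
    using eventually_gt_at_top[of 0]
    by eventually_elim (simp add: A_def D_def algebra_simps)
  ultimately have 2: "(\<lambda>k. (-1) ^ k * (real k * wp_kernel a b c k * wp_dlog a b k)) \<longlonglongrightarrow> 0"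
    using Lim_transform_eventually by fastforce
  show "(\<lambda>k. real k * wp_kernel a b c k) \<longlonglongrightarrow> 0"
    using tendsto_norm_zero[OF 1] by (intro tendsto_norm_zero_cancel[of "\<lambda>k. real k * wp_kernel a b c k"]) (simp add: abs_mult)
  show "(\<lambda>k. real k * wp_kernel a b c k * wp_dlog a b k) \<longlonglongrightarrow> 0"
    using tendsto_norm_zero[OF 2] by (intro tendsto_norm_zero_cancel[of "\<lambda>k. real k * wp_kernel a b c k * wp_dlog a b k"]) (simp add: abs_mult)
qed

section \<open>Shifting the first parameter in the infinite series\<close>

lemma sums_of_telescope:
  fixes f g h :: "nat \<Rightarrow> 'a :: real_normed_vector"
  assumes "\<And>k. f k = g k + (h k - h (Suc k))" "g sums s" "h \<longlonglongrightarrow> 0" "h 0 = 0"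
  shows "f sums s"
proof -
  have "f = (\<lambda>k. g k + (h k - h (Suc k)))" using assms(1) by (rule ext)
  then show ?thesis
    using sums_add[OF assms(2) telescope_sums'[OF assms(3)]] assms(4) by simp
qed

lemma wp_sums_step:
  assumes "a \<notin> \<int>\<^sub>\<le>\<^sub>0" "b \<notin> \<int>\<^sub>\<le>\<^sub>0" "1 + a - b \<notin> \<int>\<^sub>\<le>\<^sub>0" "1 + a - c \<notin> \<int>\<^sub>\<le>\<^sub>0" "1 + a - b - c \<noteq> 0"
    and "2 * b + 2 * c < a + 2"
    and S: "wp_term (a + 1) b c sums S" and T: "(\<lambda>k. wp_term (a + 1) b c k * wp_dlog (a + 1) b k) sums T"
  shows "wp_term a b c sums (wp_ratio a b c * S)"
    and "(\<lambda>k. wp_term a b c k * wp_dlog a b k) sums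
           (wp_ratio a b c * (T + (1 / (1 + a - b) - 1 / (1 + a - b - c)) * S))"
proof -
  note bd = wp_boundary_tendsto_0[OF assms(2,3,4,6)]
  show "wp_term a b c sums (wp_ratio a b c * S)"
    by (rule sums_of_telescope[OF wp_telescope[OF assms(1,3,4)] sums_mult[OF S] bd(1)]) simp
  show "(\<lambda>k. wp_term a b c k * wp_dlog a b k) sums
           (wp_ratio a b c * (T + (1 / (1 + a - b) - 1 / (1 + a - b - c)) * S))"
    by (rule sums_of_telescope[OF wp_telescope_deriv[OF assms(1-5)]
          sums_mult[OF sums_add[OF T sums_mult[OF S]]] bd(2)]) simp
qed

lemma wp_sums_iterate:
  assumes "a \<notin> \<int>\<^sub>\<le>\<^sub>0" "b \<notin> \<int>\<^sub>\<le>\<^sub>0" "1 + a - b \<notin> \<int>\<^sub>\<le>\<^sub>0" "1 + a - c \<notin> \<int>\<^sub>\<le>\<^sub>0" "1 + a - b - c \<notin> \<int>\<^sub>\<le>\<^sub>0"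
    and "2 * b + 2 * c < a + 2"
    and "wp_term (a + real N) b c sums S"
    and "(\<lambda>k. wp_term (a + real N) b c k * wp_dlog (a + real N) b k) sums T"
  defines "P \<equiv> pochhammer (1 + a) N * pochhammer (1 + a - b - c) N /
                (pochhammer (1 + a - b) N * pochhammer (1 + a - c) N)"
  shows "wp_term a b c sums (P * S) \<and>
    (\<lambda>k. wp_term a b c k * wp_dlog a b k) sums
           (P * (T + (\<Sum>j<N. 1 / (1 + a - b + real j) - 1 / (1 + a - b - c + real j)) * S))"
  using assms(1-8) unfolding P_def
proof (induction N arbitrary: a)
  case 0
  then show ?case by simp
next
  case (Suc N)
  define P' where "P' = pochhammer (1 + (a + 1)) N * pochhammer (1 + (a + 1) - b - c) N /
                (pochhammer (1 + (a + 1) - b) N * pochhammer (1 + (a + 1) - c) N)"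
  define D' where "D' = (\<Sum>j<N. 1 / (1 + (a + 1) - b + real j) - 1 / (1 + (a + 1) - b - c + real j))"
  note prems = Suc.prems
  have shift: "a + 1 \<notin> \<int>\<^sub>\<le>\<^sub>0" "1 + (a + 1) - b \<notin> \<int>\<^sub>\<le>\<^sub>0" "1 + (a + 1) - c \<notin> \<int>\<^sub>\<le>\<^sub>0" "1 + (a + 1) - b - c \<notin> \<int>\<^sub>\<le>\<^sub>0"
    using prems(1,3,4,5)[THEN nonpos_Ints_plus_of_nat, of 1] by (simp_all add: algebra_simps)
  have e: "a + 1 + real N = a + real (Suc N)" by simp
  have nz: "1 + a - b - c \<noteq> 0" using prems(5) by auto
  have "2 * b + 2 * c < (a + 1) + 2" using prems(6) by simp
  note IH = Suc.IH[of "a + 1", unfolded e, OF shift(1) prems(2) shift(2-4) this prems(7,8)]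
  have r: "pochhammer (1 + a) (Suc N) * pochhammer (1 + a - b - c) (Suc N) /
                (pochhammer (1 + a - b) (Suc N) * pochhammer (1 + a - c) (Suc N)) = wp_ratio a b c * P'"
    unfolding pochhammer_rec P'_def wp_ratio_def by (simp add: add_ac diff_add_eq add_diff_eq mult_ac)
  have d: "(\<Sum>j<Suc N. 1 / (1 + a - b + real j) - 1 / (1 + a - b - c + real j)) =
      (1 / (1 + a - b) - 1 / (1 + a - b - c)) + D'"
    unfolding D'_def sum.lessThan_Suc_shift by (simp add: algebra_simps)
  have m: "wp_ratio a b c * P' * (T + ((1 / (1 + a - b) - 1 / (1 + a - b - c)) + D') * S) =
      wp_ratio a b c * (P' * (T + D' * S) + (1 / (1 + a - b) - 1 / (1 + a - b - c)) * (P' * S))"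
    by (simp only: ring_distribs mult_ac add_ac)
  show ?case
    using wp_sums_step[OF prems(1-4) nz prems(6) conjunct1[OF IH] conjunct2[OF IH]]
    unfolding r d m P'_def[symmetric] D'_def[symmetric] by (simp only: mult.assoc simp_thms)
qed

section \<open>The limit of a large first parameter\<close>

lemma abs_pochhammer_le:
  fixes x y :: "'a :: linordered_idom"
  assumes "\<bar>x\<bar> \<le> y"
  shows "\<bar>pochhammer x k\<bar> \<le> pochhammer y k"
proof (induction k)
  case (Suc k)
  have "\<bar>x + of_nat k\<bar> \<le> y + of_nat k"
    using assms abs_triangle_ineq[of x "of_nat k"] by simp
  with Suc show ?case
    by (simp add: pochhammer_Suc abs_mult mult_mono)
qed simp

text \<open>
  Factor by factor this is \<open>(x + k)\<^sup>2 \<le> (1 + k) (x\<^sup>2 + k)\<close>, whose defect is \<open>k (x - 1)\<^sup>2\<close>. It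
  trades the product \<open>(b)\<^sub>k (c)\<^sub>k / k!\<close> for a single Pochhammer symbol.
\<close>

lemma pochhammer_square_le:
  fixes x :: real
  assumes "x \<ge> 0"
  shows "pochhammer x k ^ 2 \<le> fact k * pochhammer (x ^ 2) k"
proof (induction k)
  case (Suc k)
  have "0 \<le> real k * (x - 1) ^ 2" by simp
  then have "(x + real k) ^ 2 \<le> (1 + real k) * (x ^ 2 + real k)"
    by (simp add: power2_eq_square algebra_simps)
  from mult_mono[OF Suc this] show ?case
    using assms by (simp add: pochhammer_Suc power_mult_distrib mult_ac prod_nonneg pochhammer_prod)
qed simp

text \<open>
  The quotient telescopes to \<open>(x)\<^sub>4 / (x + k)\<^sub>4\<close>.
\<close>

lemma pochhammer_div_le:
  fixes x :: real
  assumes "x \<ge> 1"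
  shows "pochhammer x k / pochhammer (x + 4) k \<le> pochhammer x 4 / (1 + real k) ^ 4"
proof -
  have "pochhammer x 4 * pochhammer (x + 4) k = pochhammer x k * pochhammer (x + real k) 4"
    using pochhammer_product'[of x 4 k] pochhammer_product'[of x k 4] by (simp add: add.commute)
  moreover have "(1 + real k) ^ 4 \<le> pochhammer (x + real k) 4"
    unfolding pochhammer_prod
    using assms prod_mono[of "{0..<4::nat}" "\<lambda>_. 1 + real k" "\<lambda>i. x + real k + of_nat i"] by simp
  moreover have "pochhammer x k > 0" "pochhammer (x + 4) k > 0"
    using assms by (intro pochhammer_pos; simp)+
  ultimately show ?thesis
    by (simp add: divide_simps mult_left_mono)
qed

lemma pochhammer_ge_scaled:
  fixes x y :: real
  assumes "0 < x" "x \<le> y"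
  shows "y / x * pochhammer x (Suc k) \<le> pochhammer y (Suc k)"
proof -
  have "pochhammer (x + 1) k \<le> pochhammer (y + 1) k"
    using abs_pochhammer_le[of "x + 1" "y + 1" k] assms by simp
  then show ?thesis
    using assms by (simp add: pochhammer_rec)
qed

lemma wp_dlog_bound:
  assumes "b \<le> 1" 
  obtains B where "B > 0" "\<And>a k. a \<ge> 1 \<Longrightarrow> \<bar>wp_dlog a b k\<bar> \<le> real k * B"
proof -
  have "(\<lambda>j. 1 / (b + real j)) \<longlonglongrightarrow> 0" by real_asymp
  then have "Bseq (\<lambda>j. 1 / (b + real j))"
    by (intro convergent_imp_Bseq) (auto simp: convergent_def)
  then obtain B where B: "B > 0" "\<And>j. \<bar>1 / (b + real j)\<bar> \<le> B"
    unfolding Bseq_def by auto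
  show ?thesis
  proof (rule that[of "B + 1"])
    fix a :: real and k :: nat assume a: "a \<ge> 1"
    have "\<bar>wp_dlog a b k\<bar> \<le> (\<Sum>j<k. \<bar>1 / (b + real j) + 1 / (1 + a - b + real j)\<bar>)"
      unfolding wp_dlog_def by (rule sum_abs)
    also have "\<dots> \<le> (\<Sum>j<k. B + 1)"
    proof (rule sum_mono)
      fix j
      have "\<bar>1 / (1 + a - b + real j)\<bar> \<le> 1" using a assms by (simp add: field_simps)
      with B(2)[of j] show "\<bar>1 / (b + real j) + 1 / (1 + a - b + real j)\<bar> \<le> B + 1" by linarith
    qed
    finally show "\<bar>wp_dlog a b k\<bar> \<le> real k * (B + 1)" by simp
  qed (use B in simp)
qed

text \<open>
  For \<open>k \<ge> 1\<close> and large \<open>a\<close> the terms are of order \<open>1 / a\<close>, with a cubic decay in \<open>k\<close> that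
  does not depend on \<open>a\<close>. As \<open>b\<close> and \<open>c\<close> are at most \<open>1\<close>, both \<open>(1 + a - b)\<^sub>k\<close> and
  \<open>(1 + a - c)\<^sub>k\<close> dominate \<open>(a)\<^sub>k\<close>; what is left is \<open>(1 + 2 k) (D)\<^sub>k / (a)\<^sub>k\<close> with \<open>D\<close>
  independent of \<open>a\<close>, and \<open>(a)\<^sub>k\<close> is at least \<open>(a / A) (A)\<^sub>k\<close>.
\<close>

lemma wp_term_bound:
  assumes "b \<le> 1" "c \<le> 1"
  obtains A C where "A \<ge> 1" "\<And>a k. a \<ge> A \<Longrightarrow> \<bar>wp_term a b c (Suc k)\<bar> \<le> C / (a * real (Suc (Suc k)) ^ 3)"
proof -
  define M where "M = Max {1, \<bar>b\<bar>, \<bar>c\<bar>}"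
  have M: "1 \<le> M" "\<bar>b\<bar> \<le> M" "\<bar>c\<bar> \<le> M" unfolding M_def by auto
  define D where "D = M ^ 2"
  have D: "D \<ge> 1" using M by (simp add: D_def)
  \<comment> \<open>The shift by 4 yields decay of order 4. One order is lost to the factor \<open>1 + 2 k\<close>, another
    one will be lost to the logarithmic derivative, and the rest is summable.\<close>
  define A where "A = D + 4"
  define C where "C = 2 * A * pochhammer D 4"
  show ?thesis
  proof (rule that[of A C])
    fix a :: real and k' :: nat
    assume a: "a \<ge> A"
    define k where "k = Suc k'"
    have a1: "a \<ge> 1" using a D by (simp add: A_def)
    have pa: "pochhammer a k > 0" and pA: "pochhammer A k > 0" and p4: "pochhammer D 4 > 0"
      and pD: "pochhammer D k > 0"
      using a1 D by (auto intro!: pochhammer_pos simp: A_def)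
    have x: "pochhammer a k \<le> pochhammer (1 + a - b) k" "pochhammer a k \<le> pochhammer (1 + a - c) k"
      using abs_pochhammer_le[of a "1 + a - b" k] abs_pochhammer_le[of a "1 + a - c" k] assms a1 pa by auto
    have "\<bar>pochhammer b k\<bar> * \<bar>pochhammer c k\<bar> \<le> pochhammer M k * pochhammer M k"
      using abs_pochhammer_le[OF M(2)] abs_pochhammer_le[OF M(3)] M by (intro mult_mono) (auto intro: pochhammer_nonneg)
    also have "\<dots> \<le> fact k * pochhammer D k"
      using pochhammer_square_le[of M k] M by (simp add: D_def power2_eq_square)
    finally have bc: "\<bar>pochhammer b k\<bar> * \<bar>pochhammer c k\<bar> \<le> fact k * pochhammer D k" .
    have "\<bar>wp_term a b c k\<bar> = (a + 2 * real k) / a * (pochhammer a k * (\<bar>pochhammer b k\<bar> * \<bar>pochhammer c k\<bar>) /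
       (fact k * (pochhammer (1 + a - b) k * pochhammer (1 + a - c) k)))"
      using a1 x pa by (simp add: wp_term_def wp_kernel_def abs_mult mult_ac power_abs)
    also have "\<dots> \<le> (1 + 2 * real k) * (pochhammer a k * (fact k * pochhammer D k) /
       (fact k * (pochhammer a k * pochhammer a k)))"
    proof (rule mult_mono)
      have "real k * 1 \<le> real k * a" using a1 by (intro mult_left_mono) auto
      then show "(a + 2 * real k) / a \<le> 1 + 2 * real k"
        using a1 by (simp add: field_simps)
      show "pochhammer a k * (\<bar>pochhammer b k\<bar> * \<bar>pochhammer c k\<bar>) /
       (fact k * (pochhammer (1 + a - b) k * pochhammer (1 + a - c) k)) \<le> pochhammer a k * (fact k * pochhammer D k) /
       (fact k * (pochhammer a k * pochhammer a k))"
      proof (rule frac_le)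
        show "fact k * (pochhammer a k * pochhammer a k)
            \<le> fact k * (pochhammer (1 + a - b) k * pochhammer (1 + a - c) k)"
          using x pa by (intro mult_left_mono mult_mono) auto
      qed (use bc pa pD in auto)
    qed (use a1 x pa in auto)
    also have "\<dots> = (1 + 2 * real k) * (pochhammer D k / pochhammer a k)"
      using pa by simp
    also have "\<dots> \<le> (1 + 2 * real k) * (pochhammer D k / (a / A * pochhammer A k))"
    proof (intro mult_left_mono frac_le)
      show "a / A * pochhammer A k \<le> pochhammer a k"
        unfolding k_def using D a by (intro pochhammer_ge_scaled) (auto simp: A_def)
      show "0 < a / A * pochhammer A k"
        using pA a1 D by (auto simp: A_def)
    qed (use pD in auto)
    also have "\<dots> = A / a * ((1 + 2 * real k) * (pochhammer D k / pochhammer A k))"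
      by simp
    also have "\<dots> \<le> A / a * ((2 * (1 + real k)) * (pochhammer D 4 / (1 + real k) ^ 4))"
      using pochhammer_div_le[OF D, of k] pD pA p4 D a1
      by (intro mult_left_mono mult_mono) (auto simp: A_def)
    also have "(2 * (1 + real k)) * (pochhammer D 4 / (1 + real k) ^ 4) = 2 * pochhammer D 4 / (1 + real k) ^ 3"
      by (simp add: divide_simps) (simp add: power_numeral_reduce)
    also have "A / a * (2 * pochhammer D 4 / (1 + real k) ^ 3) = C / (a * (1 + real k) ^ 3)"
      unfolding C_def by simp
    finally show "\<bar>wp_term a b c (Suc k')\<bar> \<le> C / (a * real (Suc (Suc k')) ^ 3)"
      by (simp add: k_def)
  qed (use D in \<open>simp add: A_def\<close>)
qed

text \<open>
  The head term is left out of the bound, so a small \<open>C\<close> forces the sum to be close to \<open>f 0\<close>.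
\<close>

lemma sums_near_head:
  fixes f :: "nat \<Rightarrow> real"
  assumes "\<And>k. \<bar>f (Suc k)\<bar> \<le> C / real (Suc k) ^ 2"
  shows "f sums suminf f" "\<bar>suminf f - f 0\<bar> \<le> C * (\<Sum>k. 1 / real (Suc k) ^ 2)"
proof -
  have Z: "summable (\<lambda>k. 1 / real (Suc k) ^ 2)"
    using inverse_squares_sums by (simp add: sums_iff add.commute)
  have Z': "(\<lambda>k. C / real (Suc k) ^ 2) sums (C * (\<Sum>k. 1 / real (Suc k) ^ 2))"
    using sums_mult[OF summable_sums[OF Z], of C] by simp
  have "summable (\<lambda>k. f (Suc k))"
    by (rule summable_comparison_test'[where N = 0, OF sums_summable[OF Z']]) (use assms in auto)
  then have f: "summable f" by (simp add: summable_Suc_iff)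
  then show "f sums suminf f" by (rule summable_sums)
  have "\<bar>suminf (\<lambda>k. f (Suc k))\<bar> \<le> suminf (\<lambda>k. C / real (Suc k) ^ 2)"
    using norm_suminf_le[of "\<lambda>k. f (Suc k)"] assms sums_summable[OF Z'] by auto
  then show "\<bar>suminf f - f 0\<bar> \<le> C * (\<Sum>k. 1 / real (Suc k) ^ 2)"
    using suminf_split_head[OF f] sums_unique[OF Z'] by simp
qed

lemma wp_sums_large:
  assumes "b \<le> 1" "c \<le> 1"
  defines "S \<equiv> \<lambda>a. suminf (wp_term a b c)" and "T \<equiv> \<lambda>a. suminf (\<lambda>k. wp_term a b c k * wp_dlog a b k)"
  shows "\<forall>\<^sub>F a in at_top. wp_term a b c sums S a \<and> (\<lambda>k. wp_term a b c k * wp_dlog a b k) sums T a"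
    and "(S \<longlongrightarrow> 1) at_top" and "(T \<longlongrightarrow> 0) at_top"
proof -
  obtain A C where A: "A \<ge> 1" 
    and C: "\<And>a k. a \<ge> A \<Longrightarrow> \<bar>wp_term a b c (Suc k)\<bar> \<le> C / (a * real (Suc (Suc k)) ^ 3)"
    using wp_term_bound[OF assms(1,2)] by blast
  obtain B where B: "B > 0" "\<And>a k. a \<ge> 1 \<Longrightarrow> \<bar>wp_dlog a b k\<bar> \<le> real k * B"
    using wp_dlog_bound[OF assms(1)] by blast
  have C0: "C \<ge> 0" using order_trans[OF abs_ge_zero C[of A 0]] A by (simp add: zero_le_divide_iff)
  have t: "\<bar>wp_term a b c (Suc k)\<bar> \<le> (C / a) / real (Suc k) ^ 2" if a: "a \<ge> A" for a k
  proof -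
    have "\<bar>wp_term a b c (Suc k)\<bar> \<le> (C / a) / real (Suc (Suc k)) ^ 3"
      using C[OF a, of k] by simp
    also have "\<dots> \<le> (C / a) / real (Suc k) ^ 2"
    proof (rule divide_left_mono)
      have "real (Suc k) ^ 2 \<le> real (Suc (Suc k)) ^ 2" by (intro power_mono) auto
      also have "\<dots> \<le> real (Suc (Suc k)) ^ 3" by (intro power_increasing) auto
      finally show "real (Suc k) ^ 2 \<le> real (Suc (Suc k)) ^ 3" .
    qed (use C0 a A in auto)
    finally show ?thesis .
  qed
  have l: "\<bar>wp_term a b c (Suc k) * wp_dlog a b (Suc k)\<bar> \<le> (B * C / a) / real (Suc k) ^ 2" if a: "a \<ge> A" for a k
  proof -
    have a0: "a \<ge> 1" using a A by simp
    have "\<bar>wp_term a b c (Suc k) * wp_dlog a b (Suc k)\<bar> \<le> (C / a) / real (Suc (Suc k)) ^ 3 * (real (Suc (Suc k)) * B)"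
      unfolding abs_mult
    proof (rule mult_mono)
      show "\<bar>wp_dlog a b (Suc k)\<bar> \<le> real (Suc (Suc k)) * B"
        using B(1) by (intro order_trans[OF B(2)[OF a0]] mult_right_mono) auto
    qed (use C[OF a, of k] C0 a0 in auto)
    also have "\<dots> = (B * C / a) / real (Suc (Suc k)) ^ 2"
      by (simp add: power_numeral_reduce del: of_nat_Suc)
    also have "\<dots> \<le> (B * C / a) / real (Suc k) ^ 2"
      using B(1) C0 a0 by (intro divide_left_mono power_mono) auto
    finally show ?thesis .
  qed
  have ev: "\<forall>\<^sub>F a in at_top. a \<ge> A" by (rule eventually_ge_at_top)
  show "\<forall>\<^sub>F a in at_top. wp_term a b c sums S a \<and> (\<lambda>k. wp_term a b c k * wp_dlog a b k) sums T a"
    using ev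
  proof eventually_elim
    case (elim a)
    show ?case unfolding S_def T_def
      using sums_near_head(1)[of "wp_term a b c", OF t[OF elim]]
        sums_near_head(1)[of "\<lambda>k. wp_term a b c k * wp_dlog a b k", OF l[OF elim]] by blast
  qed
  define Z where "Z = (\<Sum>k. 1 / real (Suc k) ^ 2)"
  have "((\<lambda>a. S a - 1) \<longlongrightarrow> 0) at_top"
  proof (rule Lim_null_comparison)
    show "\<forall>\<^sub>F a in at_top. norm (S a - 1) \<le> C / a * Z"
      using ev
    proof eventually_elim
      case (elim a)
      then show ?case using sums_near_head(2)[of "wp_term a b c", OF t[OF elim]] A
        by (simp add: S_def Z_def wp_term_def wp_kernel_def)
    qed
    show "((\<lambda>a. C / a * Z) \<longlongrightarrow> 0) at_top" by real_asymp
  qed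
  then show "(S \<longlongrightarrow> 1) at_top" by (rule LIM_zero_cancel)
  show "(T \<longlongrightarrow> 0) at_top"
  proof (rule Lim_null_comparison)
    show "\<forall>\<^sub>F a in at_top. norm (T a) \<le> B * C / a * Z"
      using ev
    proof eventually_elim
      case (elim a)
      then show ?case using sums_near_head(2)[of "\<lambda>k. wp_term a b c k * wp_dlog a b k", OF l[OF elim]]
        by (simp add: T_def Z_def wp_dlog_def)
    qed
    show "((\<lambda>a. B * C / a * Z) \<longlongrightarrow> 0) at_top" by real_asymp
  qed
qed

section \<open>The differentiated summation formula\<close>

text \<open>
  The product of the ratios collected by \<open>wp_sums_iterate\<close>. The powers in
  \<open>pochhammer_asymp\<close> cancel since \<open>(1 + a) + (1 + a - b - c) = (1 + a - b) + (1 + a - c)\<close>.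
\<close>

lemma wp_ratio_prod_tendsto:
  assumes "1 + a - b \<notin> \<int>\<^sub>\<le>\<^sub>0" "1 + a - c \<notin> \<int>\<^sub>\<le>\<^sub>0"
  shows "(\<lambda>N. pochhammer (1 + a) N * pochhammer (1 + a - b - c) N /
                (pochhammer (1 + a - b) N * pochhammer (1 + a - c) N))
         \<longlonglongrightarrow> Gamma (1 + a - b) * Gamma (1 + a - c) / (Gamma (1 + a) * Gamma (1 + a - b - c :: real))"
proof -
  define A where "A = (\<lambda>x k. pochhammer x k / (fact k * real k powr (x - 1)))"
  have "(\<lambda>k. A (1 + a) k * A (1 + a - b - c) k / (A (1 + a - b) k * A (1 + a - c) k)) \<longlonglongrightarrow>
     rGamma (1 + a) * rGamma (1 + a - b - c) / (rGamma (1 + a - b) * rGamma (1 + a - c))"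
    unfolding A_def using assms
    by (intro tendsto_intros pochhammer_asymp) (simp add: rGamma_eq_zero_iff)
  moreover have "\<forall>\<^sub>F k in sequentially. A (1 + a) k * A (1 + a - b - c) k / (A (1 + a - b) k * A (1 + a - c) k) =
     pochhammer (1 + a) k * pochhammer (1 + a - b - c) k /
                (pochhammer (1 + a - b) k * pochhammer (1 + a - c) k)"
    using eventually_gt_at_top[of 0]
  proof eventually_elim
    case (elim k)
    then have k: "real k > 0" by simp
    have "real k powr a * real k powr (a - b - c) = real k powr (a - b) * real k powr (a - c)"
      by (simp flip: powr_add)
    then have "(fact k * real k powr a) * (fact k * real k powr (a - b - c)) =
        (fact k * real k powr (a - b)) * (fact k * real k powr (a - c) :: real)"
      by (simp add: mult_ac)
    moreover have "p / x * (q / y) / (r / z * (s / w)) = p * q / (r * s)"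
      if "x * y = z * w" "z * w \<noteq> 0" for p q r s x y z w :: real
    proof -
      have "p / x * (q / y) / (r / z * (s / w)) = p * q / (r * s) * ((z * w) / (x * y))" by simp
      then show ?thesis using that by simp
    qed
    moreover have "1 + a - 1 = a" "1 + a - b - c - 1 = a - b - c" "1 + a - b - 1 = a - b" "1 + a - c - 1 = a - c"
      by simp_all
    moreover have "(fact k * real k powr (a - b)) * (fact k * real k powr (a - c)) \<noteq> (0 :: real)"
      using k by simp
    ultimately show ?case unfolding A_def by presburger
  qed
  ultimately have "(\<lambda>k. pochhammer (1 + a) k * pochhammer (1 + a - b - c) k /
                (pochhammer (1 + a - b) k * pochhammer (1 + a - c) k)) \<longlonglongrightarrow>
     rGamma (1 + a) * rGamma (1 + a - b - c) / (rGamma (1 + a - b) * rGamma (1 + a - c))"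
    by (rule Lim_transform_eventually)
  also have "rGamma (1 + a) * rGamma (1 + a - b - c) / (rGamma (1 + a - b) * rGamma (1 + a - c)) =
     Gamma (1 + a - b) * Gamma (1 + a - c) / (Gamma (1 + a) * Gamma (1 + a - b - c))"
    by (simp add: rGamma_inverse_Gamma divide_simps)
  finally show ?thesis .
qed

text \<open>
  Iterating the shift \<open>N\<close> times and letting \<open>N\<close> tend to infinity, the product of ratios tends
  to the Gamma quotient \<open>Q\<close>, the accumulated logarithmic derivatives tend to a difference of
  Digamma values, the undifferentiated series tends to its head term \<open>1\<close>, and the
  differentiated one to \<open>0\<close>. The result is the \<open>b\<close>-derivative of
  \<open>\<Sum>k. wp_term a b c k = Q\<close>.
\<close>

theorem well_poised_deriv_sums:
  assumes "a \<notin> \<int>\<^sub>\<le>\<^sub>0" "b \<notin> \<int>\<^sub>\<le>\<^sub>0" "1 + a - b \<notin> \<int>\<^sub>\<le>\<^sub>0" "1 + a - c \<notin> \<int>\<^sub>\<le>\<^sub>0" "1 + a - b - c \<notin> \<int>\<^sub>\<le>\<^sub>0"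
    and "2 * b + 2 * c < a + 2" and "b \<le> 1" "c \<le> 1"
  defines "Q \<equiv> Gamma (1 + a - b) * Gamma (1 + a - c) / (Gamma (1 + a) * Gamma (1 + a - b - c))"
  shows "(\<lambda>k. wp_term a b c k * wp_dlog a b k) sums
           (Q * (Digamma (1 + a - b - c) - Digamma (1 + a - b)))"
proof -
  define S where "S a = suminf (wp_term a b c)" for a
  define T where "T a = suminf (\<lambda>k. wp_term a b c k * wp_dlog a b k)" for a
  define P where "P = (\<lambda>N. pochhammer (1 + a) N * pochhammer (1 + a - b - c) N /
                (pochhammer (1 + a - b) N * pochhammer (1 + a - c) N))"
  define D where "D = (\<lambda>N. \<Sum>j<N. 1 / (1 + a - b + real j) - 1 / (1 + a - b - c + real j))"
  note large = wp_sums_large[OF assms(7,8), folded S_def T_def]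
  have inf: "filterlim (\<lambda>N. a + real N) at_top sequentially" by real_asymp
  have ev: "\<forall>\<^sub>F N in sequentially.
      (\<lambda>k. wp_term a b c k * wp_dlog a b k) sums (P N * (T (a + real N) + D N * S (a + real N)))"
    using filterlim_iff[THEN iffD1, OF inf, rule_format, OF large(1)]
  proof eventually_elim
    case (elim N)
    show ?case
      using wp_sums_iterate[OF assms(1-6) conjunct1[OF elim] conjunct2[OF elim], THEN conjunct2]
      unfolding P_def D_def .
  qed
  have P: "P \<longlonglongrightarrow> Q"
    unfolding P_def Q_def by (rule wp_ratio_prod_tendsto[OF assms(3,4)])
  have D: "D \<longlonglongrightarrow> Digamma (1 + a - b - c) - Digamma (1 + a - b)"
  proof -
    have "1 + a - b \<noteq> 0" "1 + a - b - c \<noteq> 0" using assms(3,5) by auto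
    from tendsto_diff[OF Digamma_LIMSEQ[OF this(2)] Digamma_LIMSEQ[OF this(1)]]
    show ?thesis by (simp add: D_def sum_subtractf divide_inverse)
  qed
  have S: "(\<lambda>N. S (a + real N)) \<longlonglongrightarrow> 1" and T: "(\<lambda>N. T (a + real N)) \<longlonglongrightarrow> 0"
    using filterlim_compose[OF large(2) inf] filterlim_compose[OF large(3) inf] .
  \<comment> \<open>For large \<open>N\<close> the \<open>g N\<close> differ only in form: each is the sum of the same series.\<close>
  have lim: "f sums l" if ev_sums: "\<forall>\<^sub>F N in sequentially. f sums (g N)" and g: "g \<longlonglongrightarrow> l" for f g and l :: real
  proof -
    obtain s where s: "f sums s"
      using eventually_happens'[OF sequentially_bot ev_sums] by auto
    from ev_sums have "\<forall>\<^sub>F N in sequentially. g N = s"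
      by eventually_elim (use s sums_unique2 in blast)
    then have "g \<longlonglongrightarrow> s" by (rule tendsto_eventually)
    with g s show ?thesis using LIMSEQ_unique by blast
  qed
  show "(\<lambda>k. wp_term a b c k * wp_dlog a b k) sums
           (Q * (Digamma (1 + a - b - c) - Digamma (1 + a - b)))"
  proof (rule lim)
    show "(\<lambda>N. P N * (T (a + real N) + D N * S (a + real N))) \<longlonglongrightarrow>
        Q * (Digamma (1 + a - b - c) - Digamma (1 + a - b))"
      using tendsto_mult[OF P tendsto_add[OF T tendsto_mult[OF D S]]] by simp
  qed (rule ev)
qed

section \<open>Specialisation to half-integer parameters\<close>

lemma odd_harm_plus_1: "odd_harm (i + 1) = odd_harm i + 1 / (2 * real_of_int i + 1)"
proof -
  have "2 * real_of_int i + 1 \<noteq> 0"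
  proof
    assume "2 * real_of_int i + 1 = 0"
    then have "real_of_int (2 * i + 1) = 0" by simp
    then have "2 * i + 1 = 0" by (simp only: of_int_eq_0_iff)
    then show False by presburger
  qed
  then have "Digamma (real_of_int i + 1 / 2 + 1) = Digamma (real_of_int i + 1 / 2) + 2 / (2 * real_of_int i + 1)"
    using Digamma_plus1[of "real_of_int i + 1 / 2"] by (simp add: field_simps)
  then show ?thesis
    using harm_ext_half[of i] harm_ext_half[of "i + 1"]
    by (simp add: harm_ext_def algebra_simps)
qed

text \<open>
  At \<open>b = a = 1/2 - m\<close> the summands \<open>1 / (b + j)\<close> add up to \<open>\<psi>(k - m + 1/2) - \<psi>(1/2 - m)\<close>, and
  the symmetry \<open>O\<^bsub>-m\<^esub> = O\<^sub>m\<close> turns the lower end into \<open>O\<^sub>m\<close>.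
\<close>

lemma wp_dlog_half:
  "wp_dlog (1 / 2 - real m) (1 / 2 - real m) k = 2 * odd_harm (int k - int m) - 2 * odd_harm (int m) + harm k"
proof (induction k)
  case 0
  show ?case using odd_harm_minus[of "int m"] by (simp add: wp_dlog_def harm_def)
next
  case (Suc k)
  have "odd_harm (int (Suc k) - int m) = odd_harm (int k - int m) + 1 / (2 * (real k - real m) + 1)"
    using odd_harm_plus_1[of "int k - int m"] by (simp add: algebra_simps)
  moreover have "1 / (1 / 2 - real m + real k) = 2 * (1 / (2 * (real k - real m) + 1))"
  proof -
    have "1 / 2 - real m + real k = (2 * (real k - real m) + 1) / 2" by (simp add: field_simps)
    then show ?thesis by (metis divide_divide_eq_right times_divide_eq_right mult.commute)
  qed
  moreover have "wp_dlog (1 / 2 - real m) (1 / 2 - real m) (Suc k) =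
      wp_dlog (1 / 2 - real m) (1 / 2 - real m) k + (1 / (1 / 2 - real m + real k) + 1 / (1 + real k))"
    by (simp add: wp_dlog_def)
  moreover have "harm (Suc k) = harm k + 1 / (1 + real k)"
    by (simp add: harm_Suc divide_inverse)
  ultimately show ?case using Suc by linarith
qed

lemma half_plus_int_notin_nonpos_Ints: "1 / 2 + real_of_int i \<notin> \<int>\<^sub>\<le>\<^sub>0"
proof
  assume "1 / 2 + real_of_int i \<in> \<int>\<^sub>\<le>\<^sub>0"
  then obtain j where "1 / 2 + real_of_int i = of_int j" by (elim nonpos_Ints_cases)
  then have "real_of_int (2 * i + 1) = real_of_int (2 * j)" by (simp add: field_simps)
  then have "2 * i + 1 = 2 * j" by (simp only: of_int_eq_iff)
  then show False by presburger
qed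

lemma pochhammer_half_minus: "pochhammer (1 / 2 - real m) m = (-1) ^ m * pochhammer (1 / 2) m"
  using pochhammer_minus'[of "1 / 2 :: real" m] pochhammer_minus[of "real m - 1/2" m]
  by simp

text \<open>
  Both sides are \<open>2\<^sup>m (1/2 - m)\<^bsub>m + k\<^esub>\<close>, split after \<open>k\<close> or after \<open>m\<close> factors. This absorbs the
  denominators \<open>2 k - 2 j + 1\<close> into shifted Pochhammer symbols.
\<close>

lemma pochhammer_half_shift:
  "pochhammer (1 / 2 - real m) k * (\<Prod>j = 1..m. 2 * real k - 2 * real j + 1) =
     (-2) ^ m * pochhammer (1 / 2) m * pochhammer (1 / 2) k"
proof -
  have "(\<Prod>j = 1..m. 2 * real k - 2 * real j + 1) = (\<Prod>j = 1..m. 2 * (1 / 2 - real m + real k + real (m - j)))"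
    by (rule prod.cong) (auto simp: of_nat_diff)
  also have "\<dots> = 2 ^ m * pochhammer (1 / 2 - real m + real k) m"
    by (simp only: prod.distrib pochhammer_prod_rev) simp
  finally have "pochhammer (1 / 2 - real m) k * (\<Prod>j = 1..m. 2 * real k - 2 * real j + 1) =
      2 ^ m * pochhammer (1 / 2 - real m) (k + m)"
    by (simp add: pochhammer_product')
  also have "\<dots> = 2 ^ m * (pochhammer (1 / 2 - real m) m * pochhammer (1 / 2) k)"
    using pochhammer_product'[of "1 / 2 - real m" m k] by (simp add: add.commute)
  also have "\<dots> = (2 * (-1)) ^ m * pochhammer (1 / 2) m * pochhammer (1 / 2) k"
    by (simp only: pochhammer_half_minus power_mult_distrib mult_ac)
  finally show ?thesis by simp
qed

lemma prod_fact_shift: "(\<Prod>j = 1..r. real k + real j) * fact k = fact r * pochhammer (1 + real r) k"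
proof -
  have "fact r * pochhammer (1 + real r) k = (pochhammer 1 (r + k) :: real)"
    by (simp add: pochhammer_product' pochhammer_fact)
  also have "\<dots> = fact k * pochhammer (1 + real k) r"
    using pochhammer_product'[of "1 :: real" k r] by (simp add: pochhammer_fact add.commute)
  also have "pochhammer (1 + real k) r = (\<Prod>j = 1..r. real k + real j)"
    unfolding pochhammer_prod by (rule prod.reindex_bij_witness[of _ "\<lambda>j. j - 1" Suc]) auto
  finally show ?thesis by simp
qed

lemma harm_double: "2 * odd_harm (int k) + harm k = 2 * (harm (2 * k) :: real)"
proof (induction k)
  case (Suc k)
  have "odd_harm (int (Suc k)) = odd_harm (int k) + 1 / (2 * real k + 1)"
    using odd_harm_plus_1[of "int k"] by (simp add: add.commute)
  moreover have "(harm (2 * Suc k) :: real) = harm (2 * k) + 1 / (2 * real k + 1) + 1 / (2 * real k + 2)"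
    by (simp add: harm_Suc divide_inverse add_ac)
  moreover have "(harm (Suc k) :: real) = harm k + 2 * (1 / (2 * real k + 2))"
    by (simp add: harm_Suc field_simps)
  ultimately show ?case using Suc by simp
qed (simp add: odd_harm_def harm_def)

lemma pochhammer_half_nonzero: "pochhammer (1 / 2 :: real) k \<noteq> 0"
  using pochhammer_pos[of "1 / 2 :: real" k] by simp

lemma Gamma_three_halves_minus:
  "Gamma (1 + (1 / 2 - real m)) = (1 / 2 - real m) * sqrt pi / ((-1) ^ m * pochhammer (1 / 2) m)"
proof -
  have a: "1 / 2 - real m \<notin> \<int>\<^sub>\<le>\<^sub>0"
    using half_plus_int_notin_nonpos_Ints[of "- int m"] by simp
  have "(-1) ^ m * pochhammer (1 / 2) m = sqrt pi / Gamma (1 / 2 - real m)"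
    using pochhammer_Gamma[OF a, of m] by (simp add: pochhammer_half_minus Gamma_one_half_real)
  then have "sqrt pi / ((-1) ^ m * pochhammer (1 / 2) m) = Gamma (1 / 2 - real m)"
    by simp
  moreover have "Gamma (1 + (1 / 2 - real m)) = (1 / 2 - real m) * Gamma (1 / 2 - real m)"
    using Gamma_plus1[OF a] by (simp only: add.commute)
  ultimately show ?thesis by (metis times_divide_eq_right)
qed

lemma Gamma_half_plus: "Gamma (1 / 2 + real n) = pochhammer (1 / 2) n * sqrt pi"
  using pochhammer_Gamma[of "1 / 2 :: real" n] half_plus_int_notin_nonpos_Ints[of 0]
  by (simp add: Gamma_one_half_real)

text \<open>
  The dictionary for the series: \<open>a = b = 1/2 - m\<close> and \<open>c = 1/2 - n\<close>, so that
  \<open>1 + a - b = 1\<close> and \<open>1 + a - c = 1 + (n - m)\<close>.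
\<close>

lemma summand_eq_wp_term:
  fixes m n k :: nat
  assumes "m \<le> n"
  defines "a \<equiv> 1 / 2 - real m" and "h \<equiv> pochhammer (1 / 2 :: real)"
  shows "(-1) ^ k * (h k ^ 3 / fact k ^ 3) *
           ((4 * real k + 1 - 2 * real m) * L /
            ((\<Prod>j = 1..m. (2 * real k - 2 * real j + 1) ^ 2) *
             (\<Prod>j = 1..n. 2 * real k - 2 * real j + 1) *
             (\<Prod>j = 1..n - m. real k + real j))) =
         2 * a * (-1) ^ n / (2 ^ (2 * m + n) * h m ^ 2 * h n * fact (n - m)) *
           (wp_term a a (1 / 2 - real n) k * L)"
proof -
  define q where "q r = (\<Prod>j = 1..r. 2 * real k - 2 * real j + 1)" for r
  define F where "F = (\<Prod>j = 1..n - m. real k + real j)"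
  have h: "h r \<noteq> 0" for r unfolding h_def by (rule pochhammer_half_nonzero)
  have q: "h k / q r = pochhammer (1 / 2 - real r) k / ((-2) ^ r * h r)" for r
  proof -
    have "pochhammer (1 / 2 - real r) k * q r = (-2) ^ r * h r * h k"
      unfolding q_def h_def by (rule pochhammer_half_shift)
    moreover from this have "q r \<noteq> 0" using h[of r] h[of k] by auto
    ultimately show ?thesis using h[of r] by (simp add: divide_simps)
  qed
  have F: "F * fact k = fact (n - m) * pochhammer (1 + a - (1 / 2 - real n)) k"
    using prod_fact_shift[where r = "n - m" and k = k] assms(1)
    by (simp add: F_def a_def of_nat_diff algebra_simps)
  have "a \<notin> \<int>\<^sub>\<le>\<^sub>0"
    using half_plus_int_notin_nonpos_Ints[of "- int m"] by (simp add: a_def)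
  then have a0: "a \<noteq> 0" by auto
  have s: "((-2) ^ m * h m) ^ 2 * ((-2) ^ n * h n) = (-1) ^ n * (2 ^ (2 * m + n) * h m ^ 2 * h n)"
    by (simp add: power_mult_distrib power_add power_mult power_minus[of "2 :: real" n] mult_ac flip: power_mult)
  have inv: "1 / ((-1) ^ n * x) = (-1) ^ n / x" for x :: real
    by (cases "even n") auto
  have f: "4 * real k + 1 - 2 * real m = 2 * (a + 2 * real k)" by (simp add: a_def)
  have "(-1) ^ k * (h k ^ 3 / fact k ^ 3) * ((4 * real k + 1 - 2 * real m) * L / (q m ^ 2 * q n * F)) =
      (-1) ^ k * (2 * (a + 2 * real k)) * L * ((h k / q m) ^ 2 * (h k / q n)) / (fact k * fact k * (F * fact k))"
    unfolding f by (simp add: power2_eq_square power3_eq_cube mult_ac)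
  also have "(h k / q m) ^ 2 * (h k / q n) =
      pochhammer a k ^ 2 * pochhammer (1 / 2 - real n) k * (1 / ((-1) ^ n * (2 ^ (2 * m + n) * h m ^ 2 * h n)))"
    unfolding q a_def[symmetric] s[symmetric] by (simp add: power_divide)
  also have "(-1) ^ k * (2 * (a + 2 * real k)) * L * \<dots> / (fact k * fact k * (F * fact k)) =
      2 * a * (-1) ^ n / (2 ^ (2 * m + n) * h m ^ 2 * h n * fact (n - m)) *
           (wp_term a a (1 / 2 - real n) k * L)"
    unfolding F inv wp_term_def wp_kernel_def
    using a0 by (simp add: power2_eq_square mult_ac flip: pochhammer_fact)
  finally show ?thesis
    by (simp add: q_def F_def prod_power_distrib)
qed

text \<open>
  At these parameters the Digamma difference is \<open>\<psi>(n + 1/2) - \<psi>(1) = 2 O\<^sub>n - 2 ln 2\<close>, and the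
  two half-integer Gamma values in \<open>Q\<close> contribute the factor \<open>1 / \<pi>\<close>.
\<close>

lemma half_integer_sums:
  fixes m n :: nat
  assumes "m \<le> n"
  shows "(\<lambda>k. (-1) ^ k * (pochhammer (1 / 2 :: real) k ^ 3 / fact k ^ 3) *
            ((4 * real k + 1 - 2 * real m) *
               (2 * odd_harm (int k - int m) - 2 * odd_harm (int m) + harm k) /
             ((\<Prod>j = 1..m. (2 * real k - 2 * real j + 1) ^ 2) *
              (\<Prod>j = 1..n. 2 * real k - 2 * real j + 1) *
              (\<Prod>j = 1..n - m. real k + real j))))
         sums
           ((-1) ^ (m + n) / (pochhammer (1 / 2) m * pochhammer (1 / 2) n ^ 2) *
            (1 / 2 powi (2 * int m + int n - 2)) * (1 / pi) * (odd_harm (int n) - ln 2))"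
proof -
  define a where "a = 1 / 2 - real m"
  define c where "c = 1 / 2 - real n"
  define h where "h = pochhammer (1 / 2 :: real)"
  define \<kappa> where "\<kappa> = 2 * a * (-1) ^ n / (2 ^ (2 * m + n) * h m ^ 2 * h n * fact (n - m))"
  define Q where "Q = Gamma (1 + a - a) * Gamma (1 + a - c) / (Gamma (1 + a) * Gamma (1 + a - a - c))"
  have ac: "1 + a - c = 1 + real (n - m)" "1 + a - a - c = 1 / 2 + real n"
    using assms by (simp_all add: a_def c_def)
  have a: "a \<notin> \<int>\<^sub>\<le>\<^sub>0" using half_plus_int_notin_nonpos_Ints[of "- int m"] by (simp add: a_def)
  have "(\<lambda>k. wp_term a a c k * wp_dlog a a k) sums
      (Q * (Digamma (1 + a - a - c) - Digamma (1 + a - a)))"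
    unfolding Q_def
  proof (rule well_poised_deriv_sums)
    show "1 + a - a - c \<notin> \<int>\<^sub>\<le>\<^sub>0" unfolding ac
      using half_plus_int_notin_nonpos_Ints[of "int n"] by simp
    show "1 + a - c \<notin> \<int>\<^sub>\<le>\<^sub>0" unfolding ac by (auto elim!: nonpos_Ints_cases)
  qed (use a in \<open>auto simp: a_def c_def elim!: nonpos_Ints_cases\<close>)
  also have "Digamma (1 + a - a - c) - Digamma (1 + a - a) = 2 * odd_harm (int n) - 2 * ln 2"
    unfolding ac using harm_ext_half_nat[of n] by (simp add: harm_ext_def add.commute)
  also have "2 * odd_harm (int n) - 2 * ln 2 = 2 * (odd_harm (int n) - ln 2)" by simp
  finally have "(\<lambda>k. \<kappa> * (wp_term a a c k * wp_dlog a a k)) sums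
      (\<kappa> * (Q * (2 * (odd_harm (int n) - ln 2))))"
    by (rule sums_mult)
  moreover have "\<kappa> * (Q * (2 * (odd_harm (int n) - ln 2))) =
      (-1) ^ (m + n) / (h m * h n ^ 2) * (1 / 2 powi (2 * int m + int n - 2)) * (1 / pi) * (odd_harm (int n) - ln 2)"
  proof -
    have h: "h r \<noteq> 0" for r unfolding h_def by (rule pochhammer_half_nonzero)
    have a0: "a \<noteq> 0" using a by auto
    have Q: "Q = fact (n - m) * ((-1) ^ m * h m) / (a * h n * pi)"
      unfolding Q_def ac unfolding a_def Gamma_three_halves_minus Gamma_half_plus Gamma_fact
      by (simp add: h_def mult_ac)
    have p: "2 powi (2 * int m + int n - 2) = (2 :: real) ^ (2 * m + n) / 4"
      using power_int_of_nat[of "2 :: real" "2 * m + n"]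
        power_int_diff[of "2 :: real" "int (2 * m + n)" 2] by simp
    have "2 * a * sn / (p * hm ^ 2 * hn * f) * (f * (sm * hm) / (a * hn * pi) * (2 * d)) =
        sm * sn / (hm * hn ^ 2) * (1 / (p / 4)) * (1 / pi) * d"
      if "hm \<noteq> 0" "hn \<noteq> 0" "f \<noteq> 0" for sn sm p hm hn f d :: real
      using a0 that by (simp add: power2_eq_square mult_ac)
    from this[OF h h fact_nonzero] show ?thesis
      unfolding Q \<kappa>_def p power_add[of "-1 :: real"] .
  qed
  ultimately show ?thesis
    unfolding \<kappa>_def a_def c_def h_def summand_eq_wp_term[OF assms] wp_dlog_half by (simp only:)
qed

theorem corollary21:
  shows "(\<forall>m n :: nat. m \<le> n \<longrightarrow>
           (\<lambda>k. (-1) ^ k * (pochhammer (1 / 2 :: real) k ^ 3 / fact k ^ 3) *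
                 ((4 * real k + 1 - 2 * real m) *
                    (2 * odd_harm (int k - int m) - 2 * odd_harm (int m) + harm k) /
                  ((\<Prod>j = 1..m. (2 * real k - 2 * real j + 1) ^ 2) *
                   (\<Prod>j = 1..n. 2 * real k - 2 * real j + 1) *
                   (\<Prod>j = 1..n - m. real k + real j))))
           sums
             ((-1) ^ (m + n) / (pochhammer (1 / 2) m * pochhammer (1 / 2) n ^ 2) *
              (1 / 2 powi (2 * int m + int n - 2)) * (1 / pi) * (odd_harm (int n) - ln 2)))
       \<and> (\<forall>n :: nat.
           (\<lambda>k. (-1) ^ k * (pochhammer (1 / 2 :: real) k ^ 3 / fact k ^ 3) *
                 ((4 * real k + 1) * harm (2 * k) /
                  (\<Prod>j = 1..n. (2 * real k - 2 * real j + 1) * (real k + real j))))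
           sums
             ((-1) ^ n / 2 powi (int n - 1) *
              ((odd_harm (int n) - ln 2) / pochhammer (1 / 2) n ^ 2) * (1 / pi)))
       \<and> (\<lambda>k. (-1) ^ k * (pochhammer (1 / 2 :: real) k ^ 3 / fact k ^ 3) *
               ((4 * real k + 1) * harm (2 * k)))
         sums (- (2 * ln 2 / pi))"
proof -
  have special: "(\<lambda>k. (-1) ^ k * (pochhammer (1 / 2 :: real) k ^ 3 / fact k ^ 3) *
           ((4 * real k + 1) * harm (2 * k) /
            (\<Prod>j = 1..n. (2 * real k - 2 * real j + 1) * (real k + real j))))
         sums ((-1) ^ n / 2 powi (int n - 1) *
           ((odd_harm (int n) - ln 2) / pochhammer (1 / 2) n ^ 2) * (1 / pi))" for n :: nat
  proof -
    have p: "2 powi (int n - 1) = 2 * (2 :: real) powi (int n - 2)"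
      using power_int_add[of "2 :: real" 1 "int n - 2"] by simp
    have o: "odd_harm 0 = 0" by (simp add: odd_harm_def)
    have hd: "harm (2 * k) = (2 * odd_harm (int k) + harm k) / 2" for k
      using harm_double[of k] by simp
    show ?thesis
      using sums_mult[OF half_integer_sums[of 0 n], of "1 / 2"]
      unfolding hd p prod.distrib by (simp add: o mult_ac)
  qed
  moreover have "(\<lambda>k. (-1) ^ k * (pochhammer (1 / 2 :: real) k ^ 3 / fact k ^ 3) *
               ((4 * real k + 1) * harm (2 * k)))
         sums (- (2 * ln 2 / pi))"
    using special[of 0] by (simp add: odd_harm_def power_int_minus mult_ac)
  ultimately show ?thesis using half_integer_sums by blast
qed

end
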